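(* For any $W\in\mathcal{O}_{\mathfrak{W}}$, $a,b\in\mathbb{C}$ and $\lambda\in\mathbb{C}^*$, the vector space $\mathcal{L}(W,\lambda,a,b)=W\otimes\mathbb{C}[t,t^{-1}]$ becomes a module over the Virasoro algebra $\mathfrak{V}$ with the action $$z\cdot(w\otimes t^j)=0,$$ $$d_k\cdot(w\otimes t^j)=\Big(\big((\lambda^ke^{kt}-1)\tfrac{d}{dt}+a+kb+j\big)w\Big)\otimes t^{k+j},$$ for all $k,j\in\mathbb{Z}$, $w\in W$.
   Context: The Virasoro algebra $\mathfrak{V}$ is the complex Lie algebra with basis $\{d_n,z : n\in\mathbb{Z}\}$, $z$ central, and $[d_n,d_m]=(m-n)d_{m+n}+\delta_{n,-m}\frac{n^3-n}{12}z$. $\mathfrak{W}=\mathrm{Der}(\mathbb{C}[t])$ has basis $\{d_i=t^{i+1}\frac{d}{dt} : i\ge -1\}$ with $[d_n,d_m]=(m-n)d_{m+n}$; in particular $\frac{d}{dt}=d_{-1}$. $\mathcal{O}_{\mathfrak{W}}$ is the category of all $\mathfrak{W}$-modules $W$ such that for every $w\in W$ there is a nonnegative integer $n$ (depending on $w$) with $d_iw=0$ for all $i\ge n$. Any $W\in\mathcal{O}_{\mathfrak{W}}$ is naturally a module over $\mathbb{C}[[t]]\frac{d}{dt}$, where $\big(\sum_{j\ge0}c_jt^j\big)\frac{d}{dt}$ acts as $\sum_{j\ge 0}c_jd_{j-1}$ (a finite sum on each vector). Here $e^{kt}=\sum_{j\ge0}\frac{(kt)^j}{j!}\in\mathbb{C}[[t]]$,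 so $e^{kt}\frac{d}{dt}$ acts as $\sum_{j\ge0}\frac{k^j}{j!}d_{j-1}$. $\mathbb{C}^*=\mathbb{C}\setminus\{0\}$. *)

theory Defs
  imports
    "HOL-Library.Poly_Mapping"
    "HOL-Computational_Algebra.Polynomial"
    "HOL-Computational_Algebra.Formal_Power_Series"
begin

locale lie_algebra = vector_space scale
  for scale :: "'k::field \<Rightarrow> 'l::ab_group_add \<Rightarrow> 'l" +
  fixes bracket :: "'l \<Rightarrow> 'l \<Rightarrow> 'l"
  assumes bracket_linear_left: "Vector_Spaces.linear scale scale (\<lambda>x. bracket x y)"
    and bracket_linear_right: "Vector_Spaces.linear scale scale (\<lambda>y. bracket x y)"
    and bracket_self: "bracket x x = 0"
    and jacobi: "bracket x (bracket y z) + bracket y (bracket z x) + bracket z (bracket x y) = 0"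

locale lie_module =
  lie_algebra scaleL bracket + V: vector_space scaleV
  for scaleL :: "'k::field \<Rightarrow> 'l::ab_group_add \<Rightarrow> 'l"
    and bracket :: "'l \<Rightarrow> 'l \<Rightarrow> 'l"
    and scaleV :: "'k \<Rightarrow> 'v::ab_group_add \<Rightarrow> 'v" +
  fixes act :: "'l \<Rightarrow> 'v \<Rightarrow> 'v"
  assumes act_linear_left: "Vector_Spaces.linear scaleL scaleV (\<lambda>x. act x v)"
    and act_linear_right: "Vector_Spaces.linear scaleV scaleV (\<lambda>v. act x v)"
    and act_bracket: "act (bracket x y) v = act x (act y v) - act y (act x v)"

lemma vector_space_smult: "vector_space (smult :: complex \<Rightarrow> _)"
  by unfold_locales (simp_all add: smult_add_right smult_add_left)

typedef poly_derivation =
  "{D :: complex poly \<Rightarrow> complex poly.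
      Vector_Spaces.linear smult smult D \<and> (\<forall>p q. D (p * q) = D p * q + p * D q)}"
  morphisms apply_derivation Abs_poly_derivation
proof -
  have "Vector_Spaces.linear (smult :: complex \<Rightarrow> _) smult (\<lambda>p. 0)"
    by (simp add: Vector_Spaces.linear_iff vector_space_smult)
  then show ?thesis
    by (intro exI[of _ "\<lambda>p. 0"]) simp
qed

setup_lifting type_definition_poly_derivation

lemma linear_smult_iff:
  "Vector_Spaces.linear smult smult (D :: complex poly \<Rightarrow> complex poly) \<longleftrightarrow>
    (\<forall>p q. D (p + q) = D p + D q) \<and> (\<forall>c p. D (smult c p) = smult c (D p))"
  by (simp add: Vector_Spaces.linear_iff vector_space_smult)

instantiation poly_derivation :: ab_group_add
begin

lift_definition zero_poly_derivation :: poly_derivation is "\<lambda>p. 0"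
  by (simp add: linear_smult_iff)

lift_definition plus_poly_derivation :: "poly_derivation \<Rightarrow> poly_derivation \<Rightarrow> poly_derivation"
  is "\<lambda>D E p. D p + E p"
  by (simp add: linear_smult_iff algebra_simps smult_add_right)

lift_definition minus_poly_derivation :: "poly_derivation \<Rightarrow> poly_derivation \<Rightarrow> poly_derivation"
  is "\<lambda>D E p. D p - E p"
  by (simp add: linear_smult_iff algebra_simps smult_diff_right)

lift_definition uminus_poly_derivation :: "poly_derivation \<Rightarrow> poly_derivation"
  is "\<lambda>D p. - D p"
  by (simp add: linear_smult_iff)

instance
  by standard (transfer; simp add: fun_eq_iff)+

end

lift_definition der_scale :: "complex \<Rightarrow> poly_derivation \<Rightarrow> poly_derivation"
  is "\<lambda>c D p. smult c (D p)"
  by (simp add: linear_smult_iff smult_add_right mult.commute)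

lift_definition der_commutator :: "poly_derivation \<Rightarrow> poly_derivation \<Rightarrow> poly_derivation"
  is "\<lambda>D E p. D (E p) - E (D p)"
  by (simp add: linear_smult_iff algebra_simps smult_diff_right)

text \<open>The derivation \<open>f d/dt\<close> for a polynomial \<open>f\<close>.\<close>

lift_definition poly_vector_field :: "complex poly \<Rightarrow> poly_derivation"
  is "\<lambda>f p. f * pderiv p"
  by (simp add: linear_smult_iff pderiv_add pderiv_smult pderiv_mult algebra_simps)

text \<open>
  The basis element \<open>d\<^sub>i = t\<^bsup>i+1\<^esup> d/dt\<close>.  It is meaningful for \<open>i \<ge> -1\<close> only;
  for smaller \<open>i\<close> the truncation in \<^const>\<open>nat\<close> gives a junk value.
\<close>

definition witt_d :: "int \<Rightarrow> poly_derivation" where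
  "witt_d i = poly_vector_field (monom 1 (nat (i + 1)))"

lemma apply_derivation_linear:
  "apply_derivation D (p + q) = apply_derivation D p + apply_derivation D q"
  "apply_derivation D (p - q) = apply_derivation D p - apply_derivation D q"
  "apply_derivation D (smult c p) = smult c (apply_derivation D p)"
proof -
  show add: "apply_derivation D (p + q) = apply_derivation D p + apply_derivation D q" for p q
    using apply_derivation[of D] by (simp add: linear_smult_iff)
  show "apply_derivation D (smult c p) = smult c (apply_derivation D p)"
    using apply_derivation[of D] by (simp add: linear_smult_iff)
  show "apply_derivation D (p - q) = apply_derivation D p - apply_derivation D q"
    using add[of "p - q" q] by simp
qed

lemmas apply_derivation_simps =
  plus_poly_derivation.rep_eq zero_poly_derivation.rep_eq der_scale.rep_eq
  der_commutator.rep_eq apply_derivation_linear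

lemma poly_derivation_eqI:
  "(\<And>p. apply_derivation D p = apply_derivation E p) \<Longrightarrow> D = E"
  by (simp add: apply_derivation_inject[symmetric] fun_eq_iff)

lemma lie_algebra_poly_derivation: "lie_algebra der_scale der_commutator"
proof -
  have vs: "vector_space der_scale"
    by unfold_locales
       (auto intro!: poly_derivation_eqI
         simp: apply_derivation_simps smult_add_right smult_add_left)
  have "der_commutator (x + y) z = der_commutator x z + der_commutator y z"
    "der_commutator z (x + y) = der_commutator z x + der_commutator z y"
    "der_commutator (der_scale c x) y = der_scale c (der_commutator x y)"
    "der_commutator x (der_scale c y) = der_scale c (der_commutator x y)"
    "der_commutator x x = 0"
    "der_commutator x (der_commutator y z) + der_commutator y (der_commutator z x)
      + der_commutator z (der_commutator x y) = 0" for x y z c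
    by (rule poly_derivation_eqI, simp add: apply_derivation_simps smult_diff_right)+
  then show ?thesis
    unfolding lie_algebra_def lie_algebra_axioms_def Vector_Spaces.linear_iff
    using vs by blast
qed

lemma poly_derivation_eq_vector_field:
  "D = poly_vector_field (apply_derivation D [:0, 1:])"
proof -
  have *: "E p = E [:0, 1:] * pderiv p"
    if lin: "Vector_Spaces.linear smult smult E"
      and leib: "\<And>p q. E (p * q) = E p * q + p * E q"
    for E :: "complex poly \<Rightarrow> complex poly" and p
  proof (induction p)
    case 0
    show ?case using leib[of 0 0] by simp
  next
    case (pCons c p)
    have one: "E 1 = 0" using leib[of 1 1] by simp
    have "E (pCons c p) = E (smult c 1 + [:0, 1:] * p)" by (simp add: smult_one)
    also have "\<dots> = smult c (E 1) + E ([:0, 1:] * p)"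
      using lin unfolding linear_smult_iff by metis
    also have "\<dots> = E [:0, 1:] * (p + pCons 0 (pderiv p))"
      unfolding leib one pCons.IH by (simp add: algebra_simps)
    finally show ?case by (simp add: pderiv_pCons)
  qed
  show ?thesis
    by transfer (use * in blast)
qed

lemma der_commutator_witt_d:
  assumes "n \<ge> - 1" "m \<ge> - 1"
  shows "der_commutator (witt_d n) (witt_d m) = der_scale (of_int (m - n)) (witt_d (m + n))"
proof -
  have comm: "der_commutator (poly_vector_field f) (poly_vector_field g)
      = poly_vector_field (f * pderiv g - g * pderiv f)" for f g
    by transfer (simp add: fun_eq_iff pderiv_mult algebra_simps)
  have scal: "der_scale c (poly_vector_field f) = poly_vector_field (smult c f)" for c f
    by transfer (simp add: fun_eq_iff)
  define i j where "i = nat (n + 1)" and "j = nat (m + 1)"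
  have nm: "n = int i - 1" "m = int j - 1" using assms by (auto simp: i_def j_def)
  have "monom 1 i * pderiv (monom 1 j) - monom 1 j * pderiv (monom 1 i)
      = smult (of_int (m - n)) (monom 1 (nat (m + n + 1)) :: complex poly)"
  proof (cases "i + j = 0")
    case True
    then show ?thesis by (simp add: nm pderiv_monom)
  next
    case False
    then have "nat (m + n + 1) = i + j - 1" by (auto simp: nm)
    then show ?thesis using False
      by (cases i; cases j)
         (auto simp: poly_eq_iff nm pderiv_monom mult_monom smult_monom algebra_simps)
  qed
  then show ?thesis
    by (simp add: witt_d_def comm scal nm add_ac)
qed

definition witt_category_O ::
    "(complex \<Rightarrow> 'w::ab_group_add \<Rightarrow> 'w) \<Rightarrow> (poly_derivation \<Rightarrow> 'w \<Rightarrow> 'w) \<Rightarrow> bool" where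
  "witt_category_O scaleW act \<longleftrightarrow>
     lie_module der_scale der_commutator scaleW act \<and>
     (\<forall>w. \<exists>n::nat. \<forall>i\<ge>int n. act (witt_d i) w = 0)"

text \<open>
  The action of \<open>(\<Sum>j\<ge>0. c\<^sub>j t\<^sup>j) d/dt\<close> as \<open>\<Sum>j\<ge>0. c\<^sub>j d\<^bsub>j-1\<^esub>\<close>.  On modules satisfying
  \<^const>\<open>witt_category_O\<close> only finitely many terms are nonzero, so \<^const>\<open>Sum_any\<close>
  is the actual sum there.
\<close>

definition formal_vector_field_act ::
    "(complex \<Rightarrow> 'w::ab_group_add \<Rightarrow> 'w) \<Rightarrow> (poly_derivation \<Rightarrow> 'w \<Rightarrow> 'w) \<Rightarrow>
      complex fps \<Rightarrow> 'w \<Rightarrow> 'w" where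
  "formal_vector_field_act scaleW act f w =
     (\<Sum>j::nat. scaleW (fps_nth f j) (act (witt_d (int j - 1)) w))"

lemma finite_formal_vector_field_act:
  assumes "witt_category_O scaleW act"
  shows "finite {j::nat. scaleW (fps_nth f j) (act (witt_d (int j - 1)) w) \<noteq> 0}"
proof -
  interpret lie_module der_scale der_commutator scaleW act
    using assms by (simp add: witt_category_O_def)
  obtain n :: nat where "\<forall>i\<ge>int n. act (witt_d i) w = 0"
    using assms unfolding witt_category_O_def by blast
  then have "{j::nat. scaleW (fps_nth f j) (act (witt_d (int j - 1)) w) \<noteq> 0} \<subseteq> {..n}"
    using V.scale_zero_right by (intro subsetI, rule_tac ccontr) auto
  then show ?thesis by (rule finite_subset) simp
qed

definition pm_scale ::
    "(complex \<Rightarrow> 'v::ab_group_add \<Rightarrow> 'v) \<Rightarrow> complex \<Rightarrow> ('i \<Rightarrow>\<^sub>0 'v) \<Rightarrow> ('i \<Rightarrow>\<^sub>0 'v)" where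
  "pm_scale scaleV c = Poly_Mapping.map (scaleV c)"

lemma lookup_pm_scale:
  assumes "vector_space scaleV"
  shows "Poly_Mapping.lookup (pm_scale scaleV c x) i = scaleV c (Poly_Mapping.lookup x i)"
proof -
  interpret vector_space scaleV by fact
  show ?thesis by (simp add: pm_scale_def Poly_Mapping.map.rep_eq when_def)
qed

lemma vector_space_pm_scale:
  assumes "vector_space scaleV"
  shows "vector_space (pm_scale scaleV)"
proof -
  interpret vector_space scaleV by fact
  show ?thesis
    by unfold_locales
       (auto intro!: poly_mapping_eqI simp: lookup_pm_scale[OF assms] lookup_add algebra_simps)
qed

lemma vector_space_mult: "vector_space ((*) :: complex \<Rightarrow> complex \<Rightarrow> complex)"
  by unfold_locales (simp_all add: algebra_simps)

lemma sum_keys_superset: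
  assumes "finite A" "Poly_Mapping.keys x \<subseteq> A" "\<And>j. g j 0 = 0"
  shows "(\<Sum>j\<in>Poly_Mapping.keys x. g j (Poly_Mapping.lookup x j)) = (\<Sum>j\<in>A. g j (Poly_Mapping.lookup x j))"
  using assms by (intro sum.mono_neutral_left) (auto simp: in_keys_iff)

lemma sum_keys_add:
  fixes g :: "'i \<Rightarrow> 'v::ab_group_add \<Rightarrow> 'u::ab_group_add"
  assumes g: "\<And>j u v. g j (u + v) = g j u + g j v"
  shows "(\<Sum>j\<in>Poly_Mapping.keys (x + y). g j (Poly_Mapping.lookup (x + y) j)) =
    (\<Sum>j\<in>Poly_Mapping.keys x. g j (Poly_Mapping.lookup x j)) + (\<Sum>j\<in>Poly_Mapping.keys y. g j (Poly_Mapping.lookup y j))"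
proof -
  have g0: "g j 0 = 0" for j using g[of j 0 0] by simp
  have sup: "(\<Sum>j\<in>Poly_Mapping.keys z. g j (Poly_Mapping.lookup z j)) = (\<Sum>j\<in>Poly_Mapping.keys x \<union> Poly_Mapping.keys y. g j (Poly_Mapping.lookup z j))"
    if "Poly_Mapping.keys z \<subseteq> Poly_Mapping.keys x \<union> Poly_Mapping.keys y" for z
    by (rule sum_keys_superset) (use that g0 in auto)
  show ?thesis
    using sup[of x] sup[of y] sup[of "x + y"] Poly_Mapping.keys_add[of x y]
    by (simp add: lookup_add g sum.distrib)
qed

lemma sum_keys_single:
  assumes "\<And>j. g j 0 = (0::'u::comm_monoid_add)"
  shows "(\<Sum>i\<in>Poly_Mapping.keys (Poly_Mapping.single j v). g i (Poly_Mapping.lookup (Poly_Mapping.single j v) i)) = g j v"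
  using assms by (simp add: lookup_single)

lemma poly_mapping_sum_singles:
  fixes x :: "'i \<Rightarrow>\<^sub>0 'v::ab_group_add"
  shows "x = (\<Sum>j\<in>Poly_Mapping.keys x. Poly_Mapping.single j (Poly_Mapping.lookup x j))"
  by (rule poly_mapping_eqI)
     (auto simp: lookup_sum lookup_single when_def in_keys_iff)

lemma pm_induct [case_names zero single add]:
  fixes x :: "'i \<Rightarrow>\<^sub>0 'v::ab_group_add"
  assumes zero: "P 0" and single: "\<And>j v. P (Poly_Mapping.single j v)"
    and add: "\<And>x y. P x \<Longrightarrow> P y \<Longrightarrow> P (x + y)"
  shows "P x"
proof -
  have "P (\<Sum>j\<in>A. Poly_Mapping.single j (Poly_Mapping.lookup x j))" if "finite A" for A
    using that by (induction A rule: finite_induct) (auto intro: assms)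
  then show ?thesis
    using poly_mapping_sum_singles[of x] finite_keys by metis
qed

datatype virasoro_basis = VirD int | VirZ

type_synonym virasoro = "virasoro_basis \<Rightarrow>\<^sub>0 complex"

definition vir_d :: "int \<Rightarrow> virasoro" where
  "vir_d n = Poly_Mapping.single (VirD n) 1"

definition vir_z :: virasoro where
  "vir_z = Poly_Mapping.single VirZ 1"

abbreviation vir_scale :: "complex \<Rightarrow> virasoro \<Rightarrow> virasoro" where
  "vir_scale \<equiv> pm_scale (*)"

fun vir_basis_bracket :: "virasoro_basis \<Rightarrow> virasoro_basis \<Rightarrow> virasoro" where
  "vir_basis_bracket (VirD n) (VirD m) =
     vir_scale (of_int (m - n)) (vir_d (m + n)) +
     (if n = - m then vir_scale ((of_int n ^ 3 - of_int n) / 12) vir_z else 0)"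
| "vir_basis_bracket VirZ y = 0"
| "vir_basis_bracket x VirZ = 0"

definition vir_bracket :: "virasoro \<Rightarrow> virasoro \<Rightarrow> virasoro" where
  "vir_bracket x y =
     (\<Sum>i\<in>Poly_Mapping.keys x. \<Sum>j\<in>Poly_Mapping.keys y. vir_scale (Poly_Mapping.lookup x i * Poly_Mapping.lookup y j) (vir_basis_bracket i j))"

lemma vir_bracket_singles:
  "vir_bracket (Poly_Mapping.single i c) (Poly_Mapping.single j e) =
    vir_scale (c * e) (vir_basis_bracket i j)"
proof -
  interpret vir: vector_space vir_scale
    by (rule vector_space_pm_scale[OF vector_space_mult])
  show ?thesis by (simp add: vir_bracket_def lookup_single)
qed

lemma vir_bracket_linear:
  "vir_bracket (x + y) z = vir_bracket x z + vir_bracket y z"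
  "vir_bracket z (x + y) = vir_bracket z x + vir_bracket z y"
  "vir_bracket (vir_scale c x) z = vir_scale c (vir_bracket x z)"
  "vir_bracket z (vir_scale c x) = vir_scale c (vir_bracket z x)"
proof -
  interpret vir: vector_space vir_scale
    by (rule vector_space_pm_scale[OF vector_space_mult])
  show l: "vir_bracket (x + y) z = vir_bracket x z + vir_bracket y z" for x y z
    unfolding vir_bracket_def
    by (rule sum_keys_add[where g = "\<lambda>i u. \<Sum>j\<in>Poly_Mapping.keys z.
          vir_scale (u * Poly_Mapping.lookup z j) (vir_basis_bracket i j)"])
       (simp add: algebra_simps sum.distrib)
  show r: "vir_bracket z (x + y) = vir_bracket z x + vir_bracket z y" for x y z
    unfolding vir_bracket_def sum.distrib[symmetric]
    by (rule sum.cong[OF refl], rule sum_keys_add[where g = "\<lambda>j u.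
          vir_scale (Poly_Mapping.lookup z _ * u) (vir_basis_bracket _ j)"])
       (simp add: algebra_simps)
  have sc: "vir_scale c (Poly_Mapping.single i u) = Poly_Mapping.single i (c * u)" for c i u
    by (simp add: pm_scale_def)
  have z: "vir_bracket 0 x = 0" "vir_bracket x 0 = 0" for x
    by (simp_all add: vir_bracket_def)
  have s: "vir_bracket (vir_scale c x) y = vir_scale c (vir_bracket x y) \<and>
      vir_bracket x (vir_scale c y) = vir_scale c (vir_bracket x y)" for x y
  proof (induction x rule: pm_induct)
    case (single i u)
    show ?case
      by (induction y rule: pm_induct)
         (simp_all add: z sc vir_bracket_singles r vir.scale_right_distrib mult_ac)
  qed (simp_all add: z l vir.scale_right_distrib)
  show "vir_bracket (vir_scale c x) z = vir_scale c (vir_bracket x z)"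
    and "vir_bracket z (vir_scale c x) = vir_scale c (vir_bracket z x)"
    using s by blast+
qed

lemma vir_bracket_basis:
  "vir_bracket (vir_d n) (vir_d m) =
     vir_scale (of_int (m - n)) (vir_d (m + n)) +
     (if n = - m then vir_scale ((of_int n ^ 3 - of_int n) / 12) vir_z else 0)"
  "vir_bracket vir_z x = 0"
  "vir_bracket x vir_z = 0"
proof -
  interpret vir: vector_space vir_scale
    by (rule vector_space_pm_scale[OF vector_space_mult])
  show "vir_bracket (vir_d n) (vir_d m) =
     vir_scale (of_int (m - n)) (vir_d (m + n)) +
     (if n = - m then vir_scale ((of_int n ^ 3 - of_int n) / 12) vir_z else 0)"
    unfolding vir_d_def vir_z_def vir_bracket_singles by (simp add: vir_d_def vir_z_def)
  show "vir_bracket vir_z x = 0" by (simp add: vir_bracket_def vir_z_def)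
  have "vir_basis_bracket i VirZ = 0" for i by (cases i) auto
  then show "vir_bracket x vir_z = 0" by (simp add: vir_bracket_def vir_z_def)
qed

lemma vir_induct:
  assumes "\<And>n. P (vir_d n)" "P vir_z"
    and "\<And>c x. P x \<Longrightarrow> P (vir_scale c x)" "\<And>x y. P x \<Longrightarrow> P y \<Longrightarrow> P (x + y)"
  shows "P (x :: virasoro)"
proof (rule pm_induct)
  fix i :: virasoro_basis and c :: complex
  have "Poly_Mapping.single i c = vir_scale c (Poly_Mapping.single i 1)" for i :: virasoro_basis and c
    by (simp add: pm_scale_def)
  moreover have "P (Poly_Mapping.single i 1)"
    using assms(1,2) by (cases i) (auto simp: vir_d_def vir_z_def)
  ultimately show s: "P (Poly_Mapping.single i c)" using assms(3) by metis
  have "P (vir_scale 0 vir_z)" using assms by blast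
  then show "P 0" by (simp add: pm_scale_def vir_z_def)
qed (fact assms)

lemma lie_algebra_virasoro: "lie_algebra vir_scale vir_bracket"
proof -
  have vs: "vector_space vir_scale"
    by (rule vector_space_pm_scale[OF vector_space_mult])
  interpret vir: vector_space vir_scale by (fact vs)
  have anti: "vir_bracket x y = - vir_bracket y x" for x y
  proof (induction x arbitrary: y rule: vir_induct)
    case (1 n)
    show ?case
    proof (induction y rule: vir_induct)
      case (1 m)
      have "vir_scale (of_int (m - n)) (vir_d (m + n)) = - vir_scale (of_int (n - m)) (vir_d (n + m))"
        by (simp add: add.commute vir.scale_minus_left[symmetric] del: vir.scale_minus_left)
      moreover have "vir_scale ((of_int n ^ 3 - of_int n) / 12) vir_z
          = - vir_scale ((of_int m ^ 3 - of_int m) / 12) vir_z" if "n = - m"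
        using that
        by (simp add: vir.scale_minus_left[symmetric] minus_divide_left del: vir.scale_minus_left)
      ultimately show ?case
        by (cases "n = - m") (auto simp: vir_bracket_basis)
    qed (simp_all add: vir_bracket_basis vir_bracket_linear)
  qed (simp_all add: vir_bracket_basis vir_bracket_linear)
  have zero: "vir_bracket x 0 = 0" for x by (simp add: vir_bracket_def)
  have self: "vir_bracket x x = 0" for x
  proof -
    have "vir_scale 2 (vir_bracket x x) = vir_bracket x x + vir_bracket x x"
      using vir.scale_left_distrib[of 1 1 "vir_bracket x x"] by simp
    also have "\<dots> = 0" using anti[of x x] by (metis add.right_inverse)
    finally show ?thesis by simp
  qed
  have jac: "vir_bracket x (vir_bracket y z) + vir_bracket y (vir_bracket z x)
      + vir_bracket z (vir_bracket x y) = 0" for x y z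
  proof -
    have add: "a1 + b1 + c1 + (a2 + b2 + c2) = 0 \<Longrightarrow> (a1 + a2) + (b1 + b2) + (c1 + c2) = 0"
      for a1 a2 b1 b2 c1 c2 :: virasoro by (simp add: algebra_simps)
    show ?thesis
    proof (induction x arbitrary: y z rule: vir_induct)
      case (1 n)
      show ?case
      proof (induction y arbitrary: z rule: vir_induct)
        case (1 m)
        show ?case
        proof (induction z rule: vir_induct)
          case (1 l)
          define D Z where "D = vir_d (n + m + l)" and "Z = vir_z"
          have br: "vir_bracket (vir_d i) (vir_bracket (vir_d j) (vir_d k)) =
              vir_scale (of_int ((k - j) * (k + j - i))) D +
              vir_scale (if n + m + l = 0 then of_int (k - j) * (of_int i ^ 3 - of_int i) / 12 else 0) Z"
            if "i + j + k = n + m + l" for i j k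
          proof -
            have "k + j + i = n + m + l" "i = - (k + j) \<longleftrightarrow> n + m + l = 0" using that by auto
            then show ?thesis
              by (auto simp: vir_bracket_basis vir_bracket_linear vir.scale_right_distrib D_def Z_def zero)
          qed
          have perm: "m + l + n = n + m + l" "l + n + m = n + m + l" by simp_all
          have "of_int (l - m) * (of_int n ^ 3 - of_int n) / 12
              + of_int (n - l) * (of_int m ^ 3 - of_int m) / 12
              + of_int (m - n) * (of_int l ^ 3 - of_int l) / 12 = (0 :: complex)"
            if "n + m + l = 0"
          proof -
            have l: "l = - n - m" using that by simp
            show ?thesis by (simp add: l field_simps power3_eq_cube)
          qed
          then have Zc: "(if n + m + l = 0 then of_int (l - m) * (of_int n ^ 3 - of_int n) / 12 else 0)
              + (if n + m + l = 0 then of_int (n - l) * (of_int m ^ 3 - of_int m) / 12 else 0)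
              + (if n + m + l = 0 then of_int (m - n) * (of_int l ^ 3 - of_int l) / 12 else 0)
              = (0 :: complex)" (is "?u + ?v + ?w = 0") by simp
          have "(l - m) * (l + m - n) + (n - l) * (n + l - m) + (m - n) * (m + n - l) = 0"
            by (simp add: algebra_simps)
          then have Dc: "of_int ((l - m) * (l + m - n)) + of_int ((n - l) * (n + l - m))
              + of_int ((m - n) * (m + n - l)) = (0 :: complex)" (is "?p + ?q + ?r = 0")
            by (metis of_int_0 of_int_add)
          have "(vir_scale ?p D + vir_scale ?u Z) + (vir_scale ?q D + vir_scale ?v Z)
              + (vir_scale ?r D + vir_scale ?w Z) = vir_scale (?p + ?q + ?r) D + vir_scale (?u + ?v + ?w) Z"
            unfolding vir.scale_left_distrib by (simp only: add_ac)
          also have "\<dots> = 0" unfolding Zc Dc by simp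
          finally show ?case
            unfolding br[OF refl] br[OF perm(1)] br[OF perm(2)] .
        next
          case (3 c x)
          show ?case
            unfolding vir_bracket_linear(3,4) vir.scale_right_distrib[symmetric]
            by (simp only: 3 vir.scale_zero_right)
        next
          case 2
          show ?case by (simp add: vir_bracket_basis(2,3) zero)
        next
          case (4 x y)
          show ?case unfolding vir_bracket_linear(1,2) by (rule add) (simp only: 4 add_0_left)
        qed
      next
        case (3 c x)
        show ?case
          unfolding vir_bracket_linear(3,4) vir.scale_right_distrib[symmetric]
          by (simp only: 3 vir.scale_zero_right)
      next
        case 2
        show ?case by (simp add: vir_bracket_basis(2,3) zero)
      next
        case (4 x y)
        show ?case unfolding vir_bracket_linear(1,2) by (rule add) (simp only: 4 add_0_left)
      qed
    next
      case (3 c x)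
      show ?case
        unfolding vir_bracket_linear(3,4) vir.scale_right_distrib[symmetric]
        by (simp only: 3 vir.scale_zero_right)
    next
      case 2
      show ?case by (simp add: vir_bracket_basis(2,3) zero)
    next
      case (4 x y)
      show ?case unfolding vir_bracket_linear(1,2) by (rule add) (simp only: 4 add_0_left)
    qed
  qed
  show ?thesis
    unfolding lie_algebra_def lie_algebra_axioms_def Vector_Spaces.linear_iff
    by (intro conjI allI vs vir_bracket_linear self jac)
qed

text \<open>
  Laurent polynomials are \<^typ>\<open>int \<Rightarrow>\<^sub>0 complex\<close> and \<open>W \<otimes> \<complex>[t, t\<^sup>-\<^sup>1]\<close> is modelled by the
  finitely supported functions from exponents to \<open>W\<close>.
\<close>

type_synonym laurent = "int \<Rightarrow>\<^sub>0 complex"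

definition laurent_t :: "int \<Rightarrow> laurent" where
  "laurent_t j = Poly_Mapping.single j 1"

definition laurent_tensor ::
    "(complex \<Rightarrow> 'w::ab_group_add \<Rightarrow> 'w) \<Rightarrow> 'w \<Rightarrow> laurent \<Rightarrow> (int \<Rightarrow>\<^sub>0 'w)" where
  "laurent_tensor scaleW w p = Poly_Mapping.map (\<lambda>c. scaleW c w) p"

lemma lookup_laurent_tensor:
  assumes "vector_space scaleW"
  shows "Poly_Mapping.lookup (laurent_tensor scaleW w p) j = scaleW (Poly_Mapping.lookup p j) w"
proof -
  interpret vector_space scaleW by fact
  show ?thesis by (simp add: laurent_tensor_def Poly_Mapping.map.rep_eq when_def)
qed

lemma laurent_tensor_single:
  assumes "vector_space scaleW"
  shows "laurent_tensor scaleW w (Poly_Mapping.single j c) = Poly_Mapping.single j (scaleW c w)"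
proof -
  interpret vector_space scaleW by fact
  show ?thesis by (simp add: laurent_tensor_def)
qed

lemma laurent_tensor_t:
  assumes "vector_space scaleW"
  shows "laurent_tensor scaleW w (laurent_t j) = Poly_Mapping.single j w"
proof -
  interpret vector_space scaleW by fact
  show ?thesis by (simp add: laurent_tensor_def laurent_t_def)
qed

lemma laurent_tensor_linear:
  assumes "vector_space scaleW"
  shows "Vector_Spaces.linear scaleW (pm_scale scaleW) (\<lambda>w. laurent_tensor scaleW w p)"
    and "Vector_Spaces.linear (pm_scale (*)) (pm_scale scaleW) (laurent_tensor scaleW w)"
proof -
  interpret vector_space scaleW by fact
  show "Vector_Spaces.linear scaleW (pm_scale scaleW) (\<lambda>w. laurent_tensor scaleW w p)"
    and "Vector_Spaces.linear (pm_scale (*)) (pm_scale scaleW) (laurent_tensor scaleW w)"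
    unfolding Vector_Spaces.linear_iff
    by (auto intro!: poly_mapping_eqI
        simp: assms vector_space_pm_scale vector_space_mult lookup_laurent_tensor lookup_pm_scale
          lookup_add algebra_simps)
qed

text \<open>
  The universal property showing that this model, with \<^const>\<open>laurent_tensor\<close> as the map
  \<open>(w, p) \<mapsto> w \<otimes> p\<close>, is the tensor product over the complex numbers.
\<close>

lemma laurent_tensor_universal:
  fixes scaleW :: "complex \<Rightarrow> 'w::ab_group_add \<Rightarrow> 'w"
    and scaleU :: "complex \<Rightarrow> 'u::ab_group_add \<Rightarrow> 'u"
  assumes W: "vector_space scaleW"
    and B1: "\<And>p. Vector_Spaces.linear scaleW scaleU (\<lambda>w. B w p)"
    and B2: "\<And>w. Vector_Spaces.linear (pm_scale (*)) scaleU (B w)"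
  shows "\<exists>!h. Vector_Spaces.linear (pm_scale scaleW) scaleU h \<and>
    (\<forall>w p. h (laurent_tensor scaleW w p) = B w p)"
proof -
  interpret W: vector_space scaleW by fact
  interpret T: vector_space "pm_scale scaleW" by (rule vector_space_pm_scale[OF W])
  have U: "vector_space scaleU" using B1 by (simp add: Vector_Spaces.linear_iff)
  interpret U: vector_space scaleU by fact
  have Badd: "B (v + w) p = B v p + B w p" and Bsc: "B (scaleW c w) p = scaleU c (B w p)"
    and Badd': "B w (p + q) = B w p + B w q" and Bsc': "B w (pm_scale (*) c p) = scaleU c (B w p)"
    for v w p q c
    using B1 B2 by (simp_all add: Vector_Spaces.linear_iff)
  have B0: "B 0 p = 0" "B w 0 = 0" for p w using Badd[of 0 0] Badd'[of _ 0 0] by simp_all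
  define h where "h x = (\<Sum>j\<in>Poly_Mapping.keys x. B (Poly_Mapping.lookup x j) (laurent_t j))" for x
  have hadd: "h (x + y) = h x + h y" for x y
    unfolding h_def by (rule sum_keys_add) (rule Badd)
  have h1: "h (Poly_Mapping.single j w) = B w (laurent_t j)" for j w
    unfolding h_def by (rule sum_keys_single) (rule B0)
  have h0: "h 0 = 0" by (simp add: h_def)
  have sc: "pm_scale scaleW c (Poly_Mapping.single i u) = Poly_Mapping.single i (scaleW c u)" for c i u
    by (simp add: pm_scale_def)
  have hsc: "h (pm_scale scaleW c x) = scaleU c (h x)" for c x
    by (induction x rule: pm_induct)
       (simp_all add: h0 sc h1 Bsc T.scale_right_distrib hadd U.scale_right_distrib)
  have ht: "h (laurent_tensor scaleW w p) = B w p" for w p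
  proof (induction p rule: pm_induct)
    case zero
    have "laurent_tensor scaleW w 0 = 0" by (simp add: laurent_tensor_def map_eq_zero_iff)
    then show ?case by (simp add: h0 B0)
  next
    case (single j c)
    have "Poly_Mapping.single j c = pm_scale (*) c (laurent_t j)"
      by (simp add: pm_scale_def laurent_t_def)
    then have "B w (Poly_Mapping.single j c) = scaleU c (B w (laurent_t j))"
      by (simp only: Bsc')
    then show ?case by (simp add: laurent_tensor_single[OF W] h1 Bsc)
  next
    case (add p q)
    have "laurent_tensor scaleW w (p + q) = laurent_tensor scaleW w p + laurent_tensor scaleW w q"
      using laurent_tensor_linear(2)[OF W] by (simp add: Vector_Spaces.linear_iff)
    then show ?case by (simp add: hadd Badd' add)
  qed
  show ?thesis
  proof (rule ex1I[of _ h])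
    show "Vector_Spaces.linear (pm_scale scaleW) scaleU h \<and>
        (\<forall>w p. h (laurent_tensor scaleW w p) = B w p)"
      by (simp add: Vector_Spaces.linear_iff T.vector_space_axioms U hadd hsc ht)
  next
    fix g
    assume g: "Vector_Spaces.linear (pm_scale scaleW) scaleU g \<and>
        (\<forall>w p. g (laurent_tensor scaleW w p) = B w p)"
    then have gadd: "g (x + y) = g x + g y" for x y by (simp add: Vector_Spaces.linear_iff)
    have g0: "g 0 = 0" using gadd[of 0 0] by simp
    have g1: "g (Poly_Mapping.single j w) = B w (laurent_t j)" for j w
      using g laurent_tensor_t[OF W, of w j] by metis
    show "g = h"
    proof
      fix x
      show "g x = h x"
        by (induction x rule: pm_induct) (simp_all add: g0 h0 g1 h1 gadd hadd)
    qed
  qed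
qed

end

theory Submission
  imports Defs
begin

text \<open>
  Write \<open>F f\<close> for the action of the formal vector field \<open>f d/dt\<close> on \<open>W\<close>, and put
  \<open>E\<^sub>k = \<lambda>\<^sup>k e\<^bsup>kt\<^esup>\<close>.  The commutator of \<open>d\<^sub>k\<close> and \<open>d\<^sub>m\<close> on \<open>w \<otimes> t\<^bsup>j\<^esup>\<close> splits into three parts.

  \<^item> The vector fields contribute \<open>F (f g' - g f')\<close> with \<open>f = E\<^sub>k - 1\<close> and \<open>g = E\<^sub>m - 1\<close>.  Since
    \<open>E\<^sub>k E\<^sub>m = E\<^bsub>k+m\<^esub>\<close> and \<open>E\<^sub>k' = k E\<^sub>k\<close>, the series here is \<open>(m - k) E\<^bsub>k+m\<^esub> - m E\<^sub>m + k E\<^sub>k\<close>.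
  \<^item> Each operator raises the exponent \<open>j\<close> seen by the other one; this leaves
    \<open>m F (E\<^sub>m - 1) - k F (E\<^sub>k - 1)\<close>.
  \<^item> The scalars contribute \<open>(m - k) (a + (m + k) b + j)\<close>.

  In the sum of the first two the terms in \<open>E\<^sub>m\<close> and \<open>E\<^sub>k\<close> cancel and \<open>(m - k) F (E\<^bsub>k+m\<^esub> - 1)\<close>
  remains (lemma \<open>twisted_exp_operator_commutator\<close>).  So the operators represent the centreless Virasoro
  relations, and letting \<open>z\<close> act by zero gives a module.

  The one analytic point is that \<open>F\<close> turns brackets of power series into commutators
  (lemma \<open>formal_vector_field_act_commutator\<close>).  A given vector, together with its finitely many images
  occurring in the identity, is annihilated by all \<open>d\<^sub>i\<close> with \<open>i\<close> large, so on these vectors a power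
  series acts like any polynomial that agrees with it to sufficiently high order
  (lemma \<open>act_poly_vector_field\<close>); for polynomials the identity is the module axiom.

  Uniqueness holds because the formulas prescribe linear maps on spanning sets.
\<close>

section \<open>Power series vector fields on modules in the category O\<close>

lemma witt_category_O_common_bound:
  assumes O: "witt_category_O scaleW act" and "finite A"
  shows "\<exists>N::nat. \<forall>w\<in>A. \<forall>i\<ge>int N. act (witt_d i) w = 0"
proof -
  have "\<forall>w. \<exists>n::nat. \<forall>i\<ge>int n. act (witt_d i) w = 0"
    using O by (simp add: witt_category_O_def)
  then obtain n :: "'a \<Rightarrow> nat" where n: "\<And>w i. i \<ge> int (n w) \<Longrightarrow> act (witt_d i) w = 0"
    by metis
  have "n w \<le> Max (n ` A)" if "w \<in> A" for w
    using that \<open>finite A\<close> by simp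
  then show ?thesis
    by (intro exI[of _ "Max (n ` A)"]) (force intro: n)
qed

lemma formal_vector_field_act_eq_sum:
  assumes M: "lie_module der_scale der_commutator scaleW act"
    and N: "\<forall>i\<ge>int N. act (witt_d i) w = 0"
  shows "formal_vector_field_act scaleW act f w =
    (\<Sum>j\<le>N. scaleW (fps_nth f j) (act (witt_d (int j - 1)) w))"
proof -
  interpret lie_module der_scale der_commutator scaleW act by fact
  show ?thesis
    unfolding formal_vector_field_act_def
  proof (rule Sum_any.expand_superset)
    have "act (witt_d (int j - 1)) w = 0" if "j > N" for j using N that by simp
    then show "{j. scaleW (fps_nth f j) (act (witt_d (int j - 1)) w) \<noteq> 0} \<subseteq> {..N}"
      by (fastforce simp: not_le[symmetric])
  qed simp
qed

text \<open>
  Locality of the formal action: on a vector killed by \<open>d\<^sub>i\<close> for \<open>i \<ge> N\<close>, the coefficient of \<open>t\<^bsup>j\<^esup>\<close>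
  multiplies \<open>d\<^bsub>j-1\<^esub>\<close>, so only the coefficients up to \<open>t\<^bsup>N\<^esup>\<close> matter.  This transfers identities
  between polynomial derivations to power series.
\<close>

lemma act_poly_vector_field:
  assumes M: "lie_module der_scale der_commutator scaleW act"
    and N: "\<forall>i\<ge>int N. act (witt_d i) w = 0"
    and eq: "\<And>j. j \<le> N \<Longrightarrow> coeff p j = fps_nth f j"
  shows "act (poly_vector_field p) w = formal_vector_field_act scaleW act f w"
proof -
  interpret lie_module der_scale der_commutator scaleW act by fact
  have add: "act (x + y) w = act x w + act y w"
    and scale: "act (der_scale c x) w = scaleW c (act x w)" for x y c
    using act_linear_left by (simp_all add: Vector_Spaces.linear_iff)
  have zero: "act 0 w = 0" using add[of 0 0] by simp
  have pvf_add: "poly_vector_field (q + r) = poly_vector_field q + poly_vector_field r" for q r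
    by (rule poly_derivation_eqI)
      (simp add: poly_vector_field.rep_eq apply_derivation_simps algebra_simps)
  have pvf_smult: "poly_vector_field (smult c q) = der_scale c (poly_vector_field q)" for c q
    by (rule poly_derivation_eqI) (simp add: poly_vector_field.rep_eq apply_derivation_simps)
  have pvf_monom: "poly_vector_field (monom c j) = der_scale c (witt_d (int j - 1))" for c j
    using pvf_smult[of c "monom 1 j"] by (simp add: smult_monom witt_d_def)
  have pvf_zero: "poly_vector_field 0 = 0"
    by (auto intro!: poly_derivation_eqI simp: poly_vector_field.rep_eq apply_derivation_simps)
  have sum: "act (poly_vector_field (\<Sum>j\<in>A. monom (c j) j)) w =
      (\<Sum>j\<in>A. scaleW (c j) (act (witt_d (int j - 1)) w))" if "finite A" for A c
    using that by (induction A rule: finite_induct)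
      (simp_all add: pvf_zero zero pvf_add add pvf_monom scale)
  define n where "n = max (degree p) N"
  have "(\<Sum>j\<le>n. monom (coeff p j) j) = p"
    by (rule poly_as_sum_of_monoms') (simp add: n_def)
  then have "act (poly_vector_field p) w =
      (\<Sum>j\<le>n. scaleW (coeff p j) (act (witt_d (int j - 1)) w))"
    using sum[of "{..n}" "coeff p"] by simp
  also have "\<dots> = (\<Sum>j\<le>N. scaleW (coeff p j) (act (witt_d (int j - 1)) w))"
    by (rule sum.mono_neutral_right) (use N in \<open>auto simp: n_def\<close>)
  also have "\<dots> = formal_vector_field_act scaleW act f w"
    by (simp add: eq formal_vector_field_act_eq_sum[OF M N])
  finally show ?thesis .
qed

lemma formal_vector_field_act_linear:
  assumes O: "witt_category_O scaleW act"
  shows "formal_vector_field_act scaleW act (f + g) w =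
      formal_vector_field_act scaleW act f w + formal_vector_field_act scaleW act g w"
    and "formal_vector_field_act scaleW act (f - g) w =
      formal_vector_field_act scaleW act f w - formal_vector_field_act scaleW act g w"
    and "formal_vector_field_act scaleW act (fps_const c * f) w =
      scaleW c (formal_vector_field_act scaleW act f w)"
    and "formal_vector_field_act scaleW act f (v + w) =
      formal_vector_field_act scaleW act f v + formal_vector_field_act scaleW act f w"
    and "formal_vector_field_act scaleW act f (scaleW c w) =
      scaleW c (formal_vector_field_act scaleW act f w)"
proof -
  have M: "lie_module der_scale der_commutator scaleW act"
    using O by (simp add: witt_category_O_def)
  interpret lie_module der_scale der_commutator scaleW act by fact
  have add: "act x (u + u') = act x u + act x u'"
    and scale: "act x (scaleW c u) = scaleW c (act x u)" for x u u' c
    using act_linear_right by (simp_all add: Vector_Spaces.linear_iff)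
  obtain N where "\<forall>u\<in>{v, w, v + w, scaleW c w}. \<forall>i\<ge>int N. act (witt_d i) u = 0"
    using witt_category_O_common_bound[OF O, of "{v, w, v + w, scaleW c w}"] by auto
  then have sums: "formal_vector_field_act scaleW act h u =
      (\<Sum>j\<le>N. scaleW (fps_nth h j) (act (witt_d (int j - 1)) u))"
    if "u \<in> {v, w, v + w, scaleW c w}" for h u
    using that by (intro formal_vector_field_act_eq_sum[OF M]) blast
  show "formal_vector_field_act scaleW act (f + g) w =
      formal_vector_field_act scaleW act f w + formal_vector_field_act scaleW act g w"
    "formal_vector_field_act scaleW act (f - g) w =
      formal_vector_field_act scaleW act f w - formal_vector_field_act scaleW act g w"
    "formal_vector_field_act scaleW act (fps_const c * f) w =
      scaleW c (formal_vector_field_act scaleW act f w)"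
    "formal_vector_field_act scaleW act f (v + w) =
      formal_vector_field_act scaleW act f v + formal_vector_field_act scaleW act f w"
    "formal_vector_field_act scaleW act f (scaleW c w) =
      scaleW c (formal_vector_field_act scaleW act f w)"
    by (simp_all add: sums add scale V.scale_left_distrib V.scale_right_distrib
        V.scale_left_diff_distrib V.scale_sum_right sum.distrib sum_subtractf mult.commute)
qed

text \<open>
  Replace both series by truncations and use the module axiom for the resulting polynomial
  derivations.  One \<open>N\<close> must serve for \<open>w\<close> and also for \<open>F f w\<close> and \<open>F g w\<close>, on which the second
  operator acts.
\<close>

lemma formal_vector_field_act_commutator:
  assumes O: "witt_category_O scaleW act"
  defines "F \<equiv> formal_vector_field_act scaleW act"
  shows "F f (F g w) - F g (F f w) = F (f * fps_deriv g - g * fps_deriv f) w"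
proof -
  have M: "lie_module der_scale der_commutator scaleW act"
    using O by (simp add: witt_category_O_def)
  interpret lie_module der_scale der_commutator scaleW act by fact
  obtain N where N: "\<And>u i. u \<in> {w, F f w, F g w} \<Longrightarrow> i \<ge> int N \<Longrightarrow> act (witt_d i) u = 0"
    using witt_category_O_common_bound[OF O, of "{w, F f w, F g w}"] by auto
  \<comment> \<open>Differentiation lowers the order of agreement by one, hence truncation after \<open>t\<^bsup>N+1\<^esup>\<close>
      for brackets that are correct up to \<open>t\<^bsup>N\<^esup>\<close>.\<close>
  define T :: "complex fps \<Rightarrow> complex poly"
    where "T h = (\<Sum>j\<le>Suc N. monom (fps_nth h j) j)" for h
  have T: "coeff (T h) j = fps_nth h j" if "j \<le> Suc N" for h j
    using that by (simp add: T_def coeff_sum del: sum.atMost_Suc)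
  have act_T: "act (poly_vector_field (T h)) u = F h u" if "u \<in> {w, F f w, F g w}" for h u
    unfolding F_def by (rule act_poly_vector_field[OF M]) (use N[OF that] T in auto)
  have prod: "coeff (T h * pderiv (T h')) j = fps_nth (h * fps_deriv h') j"
    if "j \<le> N" for h h' j
    using that by (auto simp: coeff_mult fps_mult_nth coeff_pderiv T atMost_atLeast0
        intro!: sum.cong)
  have comm: "der_commutator (poly_vector_field p) (poly_vector_field q)
      = poly_vector_field (p * pderiv q - q * pderiv p)" for p q
    by transfer (simp add: fun_eq_iff pderiv_mult algebra_simps)
  have "F (f * fps_deriv g - g * fps_deriv f) w =
      act (poly_vector_field (T f * pderiv (T g) - T g * pderiv (T f))) w"
    unfolding F_def
    by (rule act_poly_vector_field[OF M, symmetric]) (use N prod in auto)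
  also have "\<dots> = F f (F g w) - F g (F f w)"
    by (simp add: comm[symmetric] act_bracket act_T)
  finally show ?thesis by simp
qed

section \<open>Virasoro modules from operators\<close>

text \<open>
  The Virasoro algebra has \<open>d\<^sub>k\<close> and \<open>z\<close> as a vector space basis, so linear operators may be
  assigned to them freely and extended linearly; by bilinearity the bracket relations need to be
  checked on the basis only.
\<close>

lemma virasoro_module_of_operators:
  fixes scaleV :: "complex \<Rightarrow> 'v::ab_group_add \<Rightarrow> 'v"
  assumes linD: "\<And>k. Vector_Spaces.linear scaleV scaleV (D k)"
    and linZ: "Vector_Spaces.linear scaleV scaleV Z"
    and comm: "\<And>k m x. D k (D m x) - D m (D k x) = scaleV (of_int (m - k)) (D (m + k) x)
      + (if k = - m then scaleV ((of_int k ^ 3 - of_int k) / 12) (Z x) else 0)"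
    and central: "\<And>k x. D k (Z x) = Z (D k x)"
  shows "\<exists>vact. lie_module vir_scale vir_bracket scaleV vact \<and>
    vact vir_z = Z \<and> (\<forall>k. vact (vir_d k) = D k)"
proof -
  have vsV: "vector_space scaleV" using linZ by (simp add: Vector_Spaces.linear_iff)
  interpret V: vector_space scaleV by fact
  have vs: "vector_space vir_scale" by (rule vector_space_pm_scale[OF vector_space_mult])
  interpret vir: vector_space vir_scale by fact
  define B where "B i = (case i of VirD k \<Rightarrow> D k | VirZ \<Rightarrow> Z)" for i
  have B: "B i (x + y) = B i x + B i y" "B i (scaleV c x) = scaleV c (B i x)" for i x y c
    using linD linZ by (simp_all add: B_def Vector_Spaces.linear_iff split: virasoro_basis.split)
  define vact where "vact v x =
    (\<Sum>i\<in>Poly_Mapping.keys v. scaleV (Poly_Mapping.lookup v i) (B i x))" for v x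
  have add: "vact (u + v) x = vact u x + vact v x" for u v x
    unfolding vact_def by (rule sum_keys_add) (simp add: V.scale_left_distrib)
  have vact_single: "vact (Poly_Mapping.single i c) x = scaleV c (B i x)" for i c x
    unfolding vact_def by (rule sum_keys_single) simp
  have zero: "vact 0 x = 0" for x by (simp add: vact_def)
  have scale: "vact (vir_scale c v) x = scaleV c (vact v x)" for c v x
  proof (induction v rule: pm_induct)
    case (single i e)
    have "vir_scale c (Poly_Mapping.single i e) = Poly_Mapping.single i (c * e)"
      by (simp add: pm_scale_def)
    then show ?case by (simp add: vact_single)
  qed (simp_all add: zero vir.scale_right_distrib add V.scale_right_distrib)
  have addR: "vact v (x + y) = vact v x + vact v y" for v x y
    by (simp add: vact_def B V.scale_right_distrib sum.distrib)
  have scaleR: "vact v (scaleV c x) = scaleV c (vact v x)" for v c x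
    by (simp add: vact_def B V.scale_sum_right mult.commute)
  have zeroR: "vact v 0 = 0" for v using addR[of v 0 0] by simp
  have d: "vact (vir_d k) = D k" and z: "vact vir_z = Z" for k
    by (simp_all add: fun_eq_iff vir_d_def vir_z_def vact_single B_def)
  have DZ: "D k (x + y) = D k x + D k y" "D k (scaleV c x) = scaleV c (D k x)"
     "Z (x + y) = Z x + Z y" "Z (scaleV c x) = scaleV c (Z x)" for k x y c
    using linD linZ by (simp_all add: Vector_Spaces.linear_iff)
  have "vact (vir_bracket u v) x = vact u (vact v x) - vact v (vact u x)" for u v x
  proof (induction u rule: vir_induct)
    case (1 k)
    show ?case
      by (induction v rule: vir_induct)
        (simp_all add: vir_bracket_basis vir_bracket_linear add scale zero d z comm central addR
          scaleR DZ V.scale_right_diff_distrib)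
  next
    case 2
    show ?case
      by (induction v rule: vir_induct)
        (simp_all add: vir_bracket_basis add scale zero d z central addR scaleR DZ
          flip: V.scale_right_diff_distrib)
  qed (simp_all add: vir_bracket_linear add scale addR scaleR V.scale_right_diff_distrib)
  then have "lie_module vir_scale vir_bracket scaleV vact"
    using lie_algebra_virasoro vsV
    by (simp add: lie_module_def lie_module_axioms_def Vector_Spaces.linear_iff vs add scale addR scaleR)
  then show ?thesis using d z by blast
qed

section \<open>Twisted operators on the loop space\<close>

text \<open>
  Supplies operators on \<open>W \<otimes> \<complex>[t, t\<^sup>-\<^sup>1]\<close> that are given on homogeneous elements by
  \<open>w \<otimes> t\<^bsup>j\<^esup> \<mapsto> g\<^sub>j w \<otimes> t\<^bsup>k+j\<^esup>\<close>.
\<close>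

lemma pm_shift_operator:
  fixes scaleW :: "complex \<Rightarrow> 'w::ab_group_add \<Rightarrow> 'w" and g :: "int \<Rightarrow> 'w \<Rightarrow> 'w"
  assumes g: "\<And>j. Vector_Spaces.linear scaleW scaleW (g j)"
  shows "\<exists>T. Vector_Spaces.linear (pm_scale scaleW) (pm_scale scaleW) T \<and>
    (\<forall>j w. T (Poly_Mapping.single j w) = Poly_Mapping.single (k + j) (g j w))"
proof -
  have W: "vector_space scaleW" using g by (simp add: Vector_Spaces.linear_iff)
  interpret W: vector_space scaleW by fact
  interpret T: vector_space "pm_scale scaleW" by (rule vector_space_pm_scale[OF W])
  have gadd: "g j (v + w) = g j v + g j w" and gsc: "g j (scaleW c w) = scaleW c (g j w)" for j v w c
    using g by (simp_all add: Vector_Spaces.linear_iff)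
  have g0: "g j 0 = 0" for j using gadd[of j 0 0] by simp
  have sc: "pm_scale scaleW c (Poly_Mapping.single i u) = Poly_Mapping.single i (scaleW c u)"
    for c u and i :: int
    by (simp add: pm_scale_def)
  define T where "T x = (\<Sum>j\<in>Poly_Mapping.keys x.
    Poly_Mapping.single (k + j) (g j (Poly_Mapping.lookup x j)))" for x
  have add: "T (x + y) = T x + T y" for x y
    unfolding T_def by (rule sum_keys_add) (simp add: gadd single_add)
  have single: "T (Poly_Mapping.single j w) = Poly_Mapping.single (k + j) (g j w)" for j w
    unfolding T_def by (rule sum_keys_single) (simp add: g0)
  have "T (pm_scale scaleW c x) = pm_scale scaleW c (T x)" for c x
  proof (induction x rule: pm_induct)
    case zero
    show ?case by (simp add: T_def)
  qed (simp_all add: sc single gsc add T.scale_right_distrib)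
  then show ?thesis
    by (intro exI[of _ T]) (simp add: Vector_Spaces.linear_iff T.vector_space_axioms add single)
qed

lemma linear_pm_eqI:
  assumes "Vector_Spaces.linear (pm_scale scaleW) s f" "Vector_Spaces.linear (pm_scale scaleW) s g"
    and "\<And>j w. f (Poly_Mapping.single j w) = g (Poly_Mapping.single j w)"
  shows "f x = g x"
proof -
  have add: "f (x + y) = f x + f y" "g (x + y) = g x + g y" for x y
    using assms(1,2) by (simp_all add: Vector_Spaces.linear_iff)
  have "f 0 = 0" "g 0 = 0" using add[of 0 0] by simp_all
  then show ?thesis by (induction x rule: pm_induct) (simp_all add: add assms(3))
qed

text \<open>
  The Virasoro relation, seen in one homogeneous component.  This is where the summand \<open>-1\<close> in
  \<open>E\<^sub>k - 1\<close> matters: the bracket of \<open>E\<^sub>k\<close> and \<open>E\<^sub>m\<close> alone is \<open>(m - k) E\<^bsub>k+m\<^esub>\<close>, and nothing in it could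
  cancel the terms in \<open>E\<^sub>m\<close> and \<open>E\<^sub>k\<close> that the degree shifts produce.
\<close>

lemma twisted_exp_operator_commutator:
  fixes scaleW :: "complex \<Rightarrow> 'w::ab_group_add \<Rightarrow> 'w"
    and act :: "poly_derivation \<Rightarrow> 'w \<Rightarrow> 'w"
    and lam a b :: complex
  assumes O: "witt_category_O scaleW act" and "lam \<noteq> 0"
  defines "G k j w \<equiv>
    formal_vector_field_act scaleW act (fps_const (lam powi k) * fps_exp (of_int k) - 1) w
      + scaleW (a + of_int k * b + of_int j) w"
  shows "G k (m + j) (G m j w) - G m (k + j) (G k j w) = scaleW (of_int (m - k)) (G (m + k) j w)"
proof -
  have M: "lie_module der_scale der_commutator scaleW act"
    using O by (simp add: witt_category_O_def)
  interpret lie_module der_scale der_commutator scaleW act by fact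
  define F where "F = formal_vector_field_act scaleW act"
  define E :: "int \<Rightarrow> complex fps" where "E k = fps_const (lam powi k) * fps_exp (of_int k)" for k
  define s where "s k j = a + of_int k * b + of_int j" for k j :: int
  note F_lin = formal_vector_field_act_linear[OF O, folded F_def]
  have G: "G k j w = F (E k - 1) w + scaleW (s k j) w" for k j w
    by (simp add: G_def F_def E_def s_def)
  have E_mult: "E k * E m = E (m + k)" for k m
  proof -
    have "E k * E m = fps_const (lam powi k * lam powi m) * (fps_exp (of_int k) * fps_exp (of_int m))"
      unfolding E_def fps_const_mult[symmetric] by (simp only: mult_ac)
    then show ?thesis
      using \<open>lam \<noteq> 0\<close> by (simp add: E_def power_int_add add.commute fps_exp_add_mult mult_ac)
  qed
  have E_deriv: "fps_deriv (E k - 1) = fps_const (of_int k) * E k" for k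
    by (simp add: E_def mult_ac)
  have bracket: "(E k - 1) * fps_deriv (E m - 1) - (E m - 1) * fps_deriv (E k - 1) =
      fps_const (of_int (m - k)) * (E (m + k) - 1)
        - fps_const (of_int m) * (E m - 1) + fps_const (of_int k) * (E k - 1)"
  proof -
    have "(E k - 1) * fps_deriv (E m - 1) - (E m - 1) * fps_deriv (E k - 1) =
      fps_const (of_int m) * (E k * E m - E m) - fps_const (of_int k) * (E k * E m - E k)"
      unfolding E_deriv by (simp add: algebra_simps)
    then show ?thesis
      unfolding E_mult by (simp add: algebra_simps flip: fps_const_sub)
  qed
  have FF: "F (E k - 1) (F (E m - 1) w) - F (E m - 1) (F (E k - 1) w) =
      scaleW (of_int (m - k)) (F (E (m + k) - 1) w)
        - scaleW (of_int m) (F (E m - 1) w) + scaleW (of_int k) (F (E k - 1) w)"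
    using formal_vector_field_act_commutator[OF O, folded F_def, of "E k - 1" "E m - 1" w]
    unfolding bracket F_lin(1,2)[of "_ - _"] F_lin(1) by (simp only: F_lin(2)[of "fps_const _ * _"] F_lin(3))
  have scalars: "s k (m + j) * s m j - s m (k + j) * s k j = of_int (m - k) * s (m + k) j"
    by (simp add: s_def algebra_simps)
  \<comment> \<open>The first three terms, in sum, are unchanged when \<open>k\<close> and \<open>m\<close> are exchanged, except for the order
      of the two vector fields; so only the noncommutativity and the last two terms survive.\<close>
  have GG: "G k (m + j) (G m j w) = F (E k - 1) (F (E m - 1) w) + scaleW (s m j) (F (E k - 1) w)
      + scaleW (s k j) (F (E m - 1) w) + scaleW (of_int m) (F (E m - 1) w)
      + scaleW (s k (m + j) * s m j) w" for k m
  proof -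
    have s: "s k (m + j) = s k j + of_int m" by (simp add: s_def)
    show ?thesis
      unfolding G F_lin(4,5) V.scale_right_distrib V.scale_scale
      unfolding s V.scale_left_distrib by (simp add: add_ac)
  qed
  have "G k (m + j) (G m j w) - G m (k + j) (G k j w) =
      (F (E k - 1) (F (E m - 1) w) - F (E m - 1) (F (E k - 1) w))
      + scaleW (of_int m) (F (E m - 1) w) - scaleW (of_int k) (F (E k - 1) w)
      + scaleW (s k (m + j) * s m j - s m (k + j) * s k j) w"
    unfolding GG V.scale_left_diff_distrib by (simp add: algebra_simps)
  also have "\<dots> = scaleW (of_int (m - k)) (F (E (m + k) - 1) w + scaleW (s (m + k) j) w)"
    unfolding FF scalars by (simp add: V.scale_right_distrib)
  finally show ?thesis by (simp only: G)
qed

theorem lemma3: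
  fixes scaleW :: "complex \<Rightarrow> 'w::ab_group_add \<Rightarrow> 'w"
    and act :: "poly_derivation \<Rightarrow> 'w \<Rightarrow> 'w"
    and lam a b :: complex
  assumes "witt_category_O scaleW act"
    and "lam \<noteq> 0"
  shows "\<exists>!vact :: virasoro \<Rightarrow> (int \<Rightarrow>\<^sub>0 'w) \<Rightarrow> (int \<Rightarrow>\<^sub>0 'w).
    lie_module vir_scale vir_bracket (pm_scale scaleW) vact \<and>
    (\<forall>w j. vact vir_z (laurent_tensor scaleW w (laurent_t j)) = 0) \<and>
    (\<forall>k j w. vact (vir_d k) (laurent_tensor scaleW w (laurent_t j)) =
       laurent_tensor scaleW
         (formal_vector_field_act scaleW act (fps_const (lam powi k) * fps_exp (of_int k) - 1) w
           + scaleW (a + of_int k * b + of_int j) w)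
         (laurent_t (k + j)))"
proof -
  have M: "lie_module der_scale der_commutator scaleW act"
    using assms(1) by (simp add: witt_category_O_def)
  interpret lie_module der_scale der_commutator scaleW act by fact
  have T: "vector_space (pm_scale scaleW)" by (rule vector_space_pm_scale[OF V.vector_space_axioms])
  interpret T: vector_space "pm_scale scaleW" by fact
  define G where "G k j w =
    formal_vector_field_act scaleW act (fps_const (lam powi k) * fps_exp (of_int k) - 1) w
      + scaleW (a + of_int k * b + of_int j) w" for k j w
  note tensor = laurent_tensor_t[OF V.vector_space_axioms]
  have G_linear: "Vector_Spaces.linear scaleW scaleW (G k j)" for k j
    by (simp add: G_def Vector_Spaces.linear_iff V.vector_space_axioms
        formal_vector_field_act_linear[OF assms(1)] V.scale_right_distrib mult.commute)
  have G_comm: "G k (m + j) (G m j w) - G m (k + j) (G k j w) = scaleW (of_int (m - k)) (G (m + k) j w)"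
    for k m j w
    unfolding G_def by (rule twisted_exp_operator_commutator[OF assms])
  have "\<forall>k. \<exists>D. Vector_Spaces.linear (pm_scale scaleW) (pm_scale scaleW) D \<and>
    (\<forall>j w. D (Poly_Mapping.single j w) = Poly_Mapping.single (k + j) (G k j w))"
    using pm_shift_operator G_linear by blast
  then obtain D where D_linear: "\<And>k. Vector_Spaces.linear (pm_scale scaleW) (pm_scale scaleW) (D k)"
    and D: "\<And>k j w. D k (Poly_Mapping.single j w) = Poly_Mapping.single (k + j) (G k j w)"
    by metis
  have D_lin: "D k (x + y) = D k x + D k y" "D k (pm_scale scaleW c x) = pm_scale scaleW c (D k x)"
    for k x y c
    using D_linear by (simp_all add: Vector_Spaces.linear_iff)
  have D_comm: "D k (D m x) - D m (D k x) = pm_scale scaleW (of_int (m - k)) (D (m + k) x)" for k m x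
  proof (rule linear_pm_eqI[of scaleW "pm_scale scaleW" "\<lambda>x. D k (D m x) - D m (D k x)"])
    fix j w
    have idx: "k + (m + j) = m + k + j" "m + (k + j) = m + k + j" by simp_all
    show "D k (D m (Poly_Mapping.single j w)) - D m (D k (Poly_Mapping.single j w))
        = pm_scale scaleW (of_int (m - k)) (D (m + k) (Poly_Mapping.single j w))"
      unfolding D idx single_diff[symmetric] G_comm by (simp add: pm_scale_def)
  qed (simp_all add: Vector_Spaces.linear_iff T D_lin T.scale_right_distrib
      T.scale_right_diff_distrib mult.commute)
  have D0: "D k 0 = 0" for k using D_lin(1)[of k 0 0] by simp
  have "\<exists>vact. lie_module vir_scale vir_bracket (pm_scale scaleW) vact \<and>
    vact vir_z = (\<lambda>x. 0) \<and> (\<forall>k. vact (vir_d k) = D k)"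
    by (rule virasoro_module_of_operators)
      (simp_all only: D_linear D_comm D0 T.scale_zero_right if_cancel add_0_right,
        simp add: Vector_Spaces.linear_iff T)
  then obtain vact where vact: "lie_module vir_scale vir_bracket (pm_scale scaleW) vact"
    "vact vir_z = (\<lambda>x. 0)" "\<And>k. vact (vir_d k) = D k"
    by blast
  show ?thesis
    unfolding tensor G_def[symmetric]
  proof (rule ex1I[of _ vact], goal_cases)
    case 1
    show ?case using vact by (simp add: D)
  next
    case (2 vact')
    note other = 2
    interpret X: lie_module vir_scale vir_bracket "pm_scale scaleW" vact by (fact vact)
    interpret Y: lie_module vir_scale vir_bracket "pm_scale scaleW" vact' using 2 by simp
    have left: "vact (u + v) x = vact u x + vact v x" "vact' (u + v) x = vact' u x + vact' v x"
      "vact (vir_scale c u) x = pm_scale scaleW c (vact u x)"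
      "vact' (vir_scale c u) x = pm_scale scaleW c (vact' u x)" for u v c x
      using X.act_linear_left Y.act_linear_left by (simp_all add: Vector_Spaces.linear_iff)
    have "vact' v x = vact v x" for v x
    proof (induction v rule: vir_induct)
      case (1 k)
      show ?case
        by (rule linear_pm_eqI[OF Y.act_linear_right X.act_linear_right]) (use other in \<open>simp add: vact D\<close>)
    next
      case 2
      show ?case
        by (rule linear_pm_eqI[OF Y.act_linear_right X.act_linear_right]) (use other in \<open>simp add: vact\<close>)
    qed (simp_all add: left)
    then show ?case by (simp add: fun_eq_iff)
  qed
qed

end
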